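(* Every pure genuinely multipartite entangled three-qubit state $|\psi\rangle\in\mathbb{C}^2\otimes\mathbb{C}^2\otimes\mathbb{C}^2$ violates the Bell inequality $$p(000|000)-p(100|100)-p(010|010)-p(001|001)-p(000|110)-p(000|101)\leqslant 0,$$ i.e. there exist, for each party $A_k$ ($k=1,2,3$) holding the $k$-th qubit, two two-outcome quantum measurements such that the resulting correlations $p(a_1a_2a_3|x_1x_2x_3)$ make the left-hand side strictly positive.
   Context: Three parties $A_1,A_2,A_3$ share a pure state $|\psi\rangle\in(\mathbb{C}^2)^{\otimes 3}$. Party $A_k$ has two measurement settings $x_k\in\{0,1\}$, each with outcomes $a_k\in\{0,1\}$; setting $x$ of party $A_k$ is described by positive semidefinite operators $M^{(k)}_{0|x},M^{(k)}_{1|x}$ on $\mathbb{C}^2$ with $M^{(k)}_{0|x}+M^{(k)}_{1|x}=\mathbb{1}$, and $$p(a_1a_2a_3|x_1x_2x_3)=\langle\psi|M^{(1)}_{a_1|x_1}\otimes M^{(2)}_{a_2|x_2}\otimes M^{(3)}_{a_3|x_3}|\psi\rangle .$$ A pure state $|\psi\rangle$ is genuinely multipartite entangled if for every partition of the three parties into two disjoint nonempty sets $S$ and $\bar S$ it is not of the form $|\phi_S\rangle\otimes|\phi_{\bar S}\rangle$ with $|\phi_S\rangle$, $|\phi_{\bar S}\rangle$ states of the parties in $S$ and $\bar S$, respectively. The displayed inequality is the case $n=3$ of the inequality $$\sum_{j=2}^n I^{1,j}_{\boldsymbol 0|\boldsymbol 0}\leqslant (n-2)\left[p(\boldsymbol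 0|\boldsymbol 0)-p(1\boldsymbol 0_{n-1}|1\boldsymbol 0_{n-1})\right],$$ where $\boldsymbol 0$ and $\boldsymbol 0_{n-1}$ are strings of $n$ and $n-1$ zeros and $I^{1,j}_{\boldsymbol 0|\boldsymbol 0}=p(\boldsymbol 0|\boldsymbol 0)-p(e_1|e_1)-p(e_j|e_j)-p(\boldsymbol 0|e_1+e_j)$, with $e_i$ the string having a $1$ in position $i$ and $0$ elsewhere. *)

theory Defs
  imports "HOL-Analysis.Analysis"
begin

text \<open>
  The numeral type \<^typ>\<open>2\<close> has the elements 0 and 1.  It indexes the computational basis of a
  qubit as well as measurement settings and outcomes.  The space of three qubits has the product
  basis, so the amplitude of |ijk> in \<open>\<psi>\<close> is \<open>\<psi> $ (i, j, k)\<close>.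
\<close>

type_synonym qubit = "complex ^ 2"
type_synonym qubits2 = "complex ^ (2 \<times> 2)"
type_synonym qubits3 = "complex ^ (2 \<times> 2 \<times> 2)"

text \<open>
  \<open>inner\<close> on \<open>complex ^ 'n\<close> is only the real part of the Hermitian inner product, hence the
  following definition (conjugate-linear in the first argument).
\<close>

definition braket :: "complex ^ 'n \<Rightarrow> complex ^ 'n \<Rightarrow> complex" where
  "braket u v = (\<Sum>i\<in>UNIV. cnj (u $ i) * v $ i)"

definition pos_semidef :: "complex ^ 'n ^ 'n \<Rightarrow> bool" where
  "pos_semidef A \<longleftrightarrow> (\<forall>v. braket v (A *v v) \<in> \<real> \<and> 0 \<le> Re (braket v (A *v v)))"

definition kron :: "complex ^ 'n ^ 'n \<Rightarrow> complex ^ 'm ^ 'm \<Rightarrow> complex ^ ('n \<times> 'm) ^ ('n \<times> 'm)" where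
  "kron A B = (\<chi> r c. A $ fst r $ fst c * B $ snd r $ snd c)"

definition measurement :: "(2 \<Rightarrow> complex ^ 2 ^ 2) \<Rightarrow> bool" where
  "measurement M \<longleftrightarrow> (\<forall>a. pos_semidef (M a)) \<and> M 0 + M 1 = mat 1"

text \<open>
  \<open>A x a\<close> is the operator of the first party for setting \<open>x\<close> and outcome \<open>a\<close>; likewise \<open>B\<close> and \<open>C\<close>.
  For measurements the operator below is self-adjoint, so taking the real part only converts
  the type; see \<open>braket_kron3_real\<close>.
\<close>

definition correlation ::
  "qubits3 \<Rightarrow> (2 \<Rightarrow> 2 \<Rightarrow> complex ^ 2 ^ 2) \<Rightarrow> (2 \<Rightarrow> 2 \<Rightarrow> complex ^ 2 ^ 2) \<Rightarrow> (2 \<Rightarrow> 2 \<Rightarrow> complex ^ 2 ^ 2)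
    \<Rightarrow> 2 \<times> 2 \<times> 2 \<Rightarrow> 2 \<times> 2 \<times> 2 \<Rightarrow> real" where
  "correlation \<psi> A B C = (\<lambda>(a1, a2, a3) (x1, x2, x3).
     Re (braket \<psi> (kron (A x1 a1) (kron (B x2 a2) (C x3 a3)) *v \<psi>)))"

text \<open>
  The three disjuncts are the three partitions of the parties into two nonempty sets:
  1|23, 2|13 and 3|12.
\<close>

definition biseparable :: "qubits3 \<Rightarrow> bool" where
  "biseparable \<psi> \<longleftrightarrow>
     (\<exists>(\<phi> :: qubit) (\<xi> :: qubits2). norm \<phi> = 1 \<and> norm \<xi> = 1 \<and>
        (\<forall>i j k. \<psi> $ (i, j, k) = \<phi> $ i * \<xi> $ (j, k))) \<or>
     (\<exists>(\<phi> :: qubit) (\<xi> :: qubits2). norm \<phi> = 1 \<and> norm \<xi> = 1 \<and>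
        (\<forall>i j k. \<psi> $ (i, j, k) = \<phi> $ j * \<xi> $ (i, k))) \<or>
     (\<exists>(\<phi> :: qubit) (\<xi> :: qubits2). norm \<phi> = 1 \<and> norm \<xi> = 1 \<and>
        (\<forall>i j k. \<psi> $ (i, j, k) = \<phi> $ k * \<xi> $ (i, j)))"

definition genuinely_multipartite_entangled :: "qubits3 \<Rightarrow> bool" where
  "genuinely_multipartite_entangled \<psi> \<longleftrightarrow> norm \<psi> = 1 \<and> \<not> biseparable \<psi>"

lemma pos_semidef_hermitian:
  fixes A :: "complex ^ 'n ^ 'n"
  assumes "pos_semidef A"
  shows "A $ i $ j = cnj (A $ j $ i)"
proof -
  let ?q = "\<lambda>v. braket v (A *v v)"
  have *: "?q (axis i 1 + z *s axis j 1)
     = A $ i $ i + z * A $ i $ j + cnj z * A $ j $ i + cnj z * z * A $ j $ j" for z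
  proof -
    have "A *v (axis i 1 + z *s axis j 1) = (\<chi> k. A $ k $ i + z * A $ k $ j)"
      by (simp add: vec_eq_iff matrix_vector_mult_def axis_def distrib_left sum.distrib
          if_distrib[of "\<lambda>x. _ * x"] cong: if_cong)
    then show ?thesis
      by (simp add: braket_def axis_def distrib_right distrib_left sum.distrib
          if_distrib[of cnj] if_distrib[of "\<lambda>x. _ * x"] if_distrib[of "\<lambda>x. x * _"] cong: if_cong)
  qed
  have real: "Im (?q v) = 0" for v
    using assms by (auto simp: pos_semidef_def complex_is_Real_iff)
  have d: "Im (A $ k $ k) = 0" for k
  proof -
    have "?q (axis k 1) = A $ k $ k"
      by (simp add: braket_def matrix_vector_mult_def axis_def
          if_distrib[of cnj] if_distrib[of "\<lambda>x. _ * x"] if_distrib[of "\<lambda>x. x * _"] cong: if_cong)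
    then show ?thesis using real[of "axis k 1"] by simp
  qed
  have "Im (A $ i $ j) + Im (A $ j $ i) = 0"
    using real[of "axis i 1 + 1 *s axis j 1"] unfolding *[of 1] by (simp add: d)
  moreover have "Re (A $ i $ j) - Re (A $ j $ i) = 0"
    using real[of "axis i 1 + \<i> *s axis j 1"] unfolding *[of \<i>] by (simp add: d)
  ultimately show ?thesis by (simp add: complex_eq_iff)
qed

lemma braket_hermitian_real:
  fixes A :: "complex ^ 'n ^ 'n"
  assumes "\<And>i j. A $ i $ j = cnj (A $ j $ i)"
  shows "braket v (A *v v) \<in> \<real>"
proof -
  have e: "braket v (A *v v) = (\<Sum>i\<in>UNIV. \<Sum>j\<in>UNIV. cnj (v $ i) * A $ i $ j * v $ j)"
    by (simp add: braket_def matrix_vector_mult_def sum_distrib_left mult.assoc)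
  have "cnj (braket v (A *v v)) = (\<Sum>i\<in>UNIV. \<Sum>j\<in>UNIV. v $ i * cnj (A $ i $ j) * cnj (v $ j))"
    unfolding e by simp
  also have "\<dots> = (\<Sum>i\<in>UNIV. \<Sum>j\<in>UNIV. cnj (v $ j) * A $ j $ i * v $ i)"
    by (intro sum.cong refl) (simp add: assms[symmetric] mult_ac)
  also have "\<dots> = braket v (A *v v)"
    unfolding e by (rule sum.swap)
  finally show ?thesis by (simp add: Reals_cnj_iff)
qed

lemma braket_kron3_real:
  assumes "pos_semidef P" "pos_semidef Q" "pos_semidef R"
  shows "braket v (kron P (kron Q R) *v v) \<in> \<real>"
proof (rule braket_hermitian_real)
  fix i j
  show "kron P (kron Q R) $ i $ j = cnj (kron P (kron Q R) $ j $ i)"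
    using pos_semidef_hermitian[OF assms(1), of "fst i" "fst j"]
      pos_semidef_hermitian[OF assms(2), of "fst (snd i)" "fst (snd j)"]
      pos_semidef_hermitian[OF assms(3), of "snd (snd i)" "snd (snd j)"]
    by (simp add: kron_def)
qed

end

theory Submission
  imports Defs
begin

text \<open>
  With rank-one projective measurements, write \<open>T\<close> for the trilinear form with coefficients \<open>\<psi>\<close> and
  put \<open>v = T(-, y, z)\<close>, \<open>w = T(-, y\<bottom>, z)\<close>, \<open>u = T(-, y, z\<bottom>)\<close>.  Given the settings \<open>x\<close>, \<open>y\<close>, \<open>z\<close> labelled 0,
  the settings labelled 1 can be chosen to make the three terms with a single outcome 1 vanish.
  If \<open>w\<close> is orthogonal to \<open>v\<close> and longer than \<open>v\<close>, and \<open>u\<close> is neither parallel nor orthogonal to \<open>v\<close>,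
  then choosing \<open>x\<close> such that \<open>p(000|101) = 0\<close> yields \<open>p(000|110) < p(000|000)\<close>, a violation.

  To find such \<open>y\<close> and \<open>z\<close>, choose \<open>z\<close> where the matrix \<open>T(-, -, z)\<close> is singular (the determinant is
  a quadratic form in \<open>z\<close>), move \<open>z\<close> slightly, and let \<open>y\<close> be the right singular vector belonging to
  the small singular value.  Up to exchanging the last two parties, this fails only for
  states \<open>\<omega>|010> + \<mu>|101>\<close> in suitable local bases, where a pair \<open>y\<close>, \<open>z\<close> with \<open>u = -w\<close> makes all
  five subtracted terms vanish.
\<close>

section \<open>Violation by rank-one projective measurements\<close>

definition perp :: "qubit \<Rightarrow> qubit" where
  "perp u = vector [- cnj (u $ 2), cnj (u $ 1)]"

text \<open>
  \<open>proj x\<close> projects onto the complex conjugate of \<open>x\<close>; this convention makes the amplitudes below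
  linear in \<open>x\<close>, \<open>y\<close> and \<open>z\<close>.
\<close>

definition proj :: "qubit \<Rightarrow> complex ^ 2 ^ 2" where
  "proj x = (\<chi> i j. cnj (x $ i) * x $ j)"

definition trilin :: "qubits3 \<Rightarrow> qubit \<Rightarrow> qubit \<Rightarrow> qubit \<Rightarrow> complex" where
  "trilin \<psi> x y z = (\<Sum>(i, j, k)\<in>UNIV. \<psi> $ (i, j, k) * (x $ i * y $ j * z $ k))"

text \<open>Bilinear, without the conjugate of \<open>braket\<close>: this pairing turns
  \<open>contr \<psi> y z\<close> into the amplitude \<open>trilin \<psi> x y z\<close>.\<close>

definition dot :: "qubit \<Rightarrow> qubit \<Rightarrow> complex" where
  "dot x v = x $ 1 * v $ 1 + x $ 2 * v $ 2"

definition contr :: "qubits3 \<Rightarrow> qubit \<Rightarrow> qubit \<Rightarrow> qubit" where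
  "contr \<psi> y z = (\<chi> i. \<Sum>j\<in>UNIV. \<Sum>k\<in>UNIV. \<psi> $ (i, j, k) * y $ j * z $ k)"

text \<open>Unprimed vectors are the settings 0, primed ones the settings 1, and \<open>perp\<close>
  marks outcome 1. The subtracted probabilities stand on the left, in the order of the
  inequality.\<close>

definition bell_violating :: "qubits3 \<Rightarrow> bool" where
  "bell_violating \<psi> \<longleftrightarrow> (\<exists>x x' y y' z z'.
     norm x = 1 \<and> norm x' = 1 \<and> norm y = 1 \<and> norm y' = 1 \<and> norm z = 1 \<and> norm z' = 1 \<and>
     (cmod (trilin \<psi> (perp x') y z))\<^sup>2 + (cmod (trilin \<psi> x (perp y') z))\<^sup>2
       + (cmod (trilin \<psi> x y (perp z')))\<^sup>2 + (cmod (trilin \<psi> x' y' z))\<^sup>2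
       + (cmod (trilin \<psi> x' y z'))\<^sup>2 < (cmod (trilin \<psi> x y z))\<^sup>2)"

lemma perp_nth [simp]: "perp u $ 1 = - cnj (u $ 2)" "perp u $ 2 = cnj (u $ 1)"
  by (simp_all add: perp_def)

lemma sum_qubits3:
  fixes f :: "2 \<times> 2 \<times> 2 \<Rightarrow> 'a::comm_monoid_add"
  shows "sum f UNIV = (\<Sum>i\<in>UNIV. \<Sum>j\<in>UNIV. \<Sum>k\<in>UNIV. f (i, j, k))"
  by (simp add: sum.cartesian_product flip: UNIV_Times_UNIV)

lemma trilin_expand:
  "trilin \<psi> x y z = (\<Sum>i\<in>UNIV. \<Sum>j\<in>UNIV. \<Sum>k\<in>UNIV. \<psi> $ (i, j, k) * (x $ i * y $ j * z $ k))"
  by (simp add: trilin_def sum_qubits3)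

lemma trilin_eq_dot: "trilin \<psi> x y z = dot x (contr \<psi> y z)"
  by (simp add: trilin_expand dot_def contr_def sum_2 algebra_simps)

lemma norm_qubit_sq: "(norm (x :: qubit))\<^sup>2 = (cmod (x $ 1))\<^sup>2 + (cmod (x $ 2))\<^sup>2"
  by (simp add: norm_vec_def L2_set_def sum_2 real_sqrt_pow2)

lemma norm_perp [simp]: "norm (perp x) = norm x"
  by (rule power2_eq_imp_eq) (simp_all add: norm_qubit_sq)

lemma braket_qubit: "braket u v = cnj (u $ 1) * v $ 1 + cnj (u $ 2) * v $ 2"
  for u v :: qubit
  by (simp add: braket_def sum_2)

section \<open>Rank-one projectors as measurement operators\<close>

lemma pos_semidef_proj: "pos_semidef (proj x)"
proof -
  have "braket v (proj x *v v) = complex_of_real ((cmod (dot x v))\<^sup>2)" for v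
    unfolding complex_norm_square
    by (simp add: braket_def proj_def matrix_vector_mult_def sum_2 dot_def algebra_simps)
  then show ?thesis
    by (simp add: pos_semidef_def)
qed

lemma proj_add_proj_perp:
  assumes "norm x = 1"
  shows "proj x + proj (perp x) = mat 1"
proof -
  have "complex_of_real ((cmod (x $ 1))\<^sup>2 + (cmod (x $ 2))\<^sup>2) = 1"
    using assms norm_qubit_sq[of x] by simp
  then have "x $ 1 * cnj (x $ 1) + x $ 2 * cnj (x $ 2) = 1"
    by (simp only: of_real_add complex_norm_square)
  then show ?thesis
    by (simp add: vec_eq_iff forall_2 proj_def mat_def algebra_simps)
qed

lemma measurement_proj:
  assumes "norm x = 1"
  shows "measurement (\<lambda>a. if a = 0 then proj x else proj (perp x))"
  using assms by (simp add: measurement_def pos_semidef_proj proj_add_proj_perp)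

text \<open>A product of rank-one projectors is again rank one, with entries
  \<open>cnj (X r) * X c\<close>, so its expectation is a squared amplitude.\<close>

lemma braket_kron_proj:
  "Re (braket \<psi> (kron (proj x) (kron (proj y) (proj z)) *v \<psi>)) = (cmod (trilin \<psi> x y z))\<^sup>2"
proof -
  define X where "X = (\<lambda>c :: 2 \<times> 2 \<times> 2. x $ fst c * y $ fst (snd c) * z $ snd (snd c))"
  have t: "trilin \<psi> x y z = (\<Sum>c\<in>UNIV. \<psi> $ c * X c)"
    by (simp add: trilin_def X_def case_prod_unfold)
  have "kron (proj x) (kron (proj y) (proj z)) $ r $ c = cnj (X r) * X c" for r c
    by (simp add: kron_def proj_def X_def)
  then have "braket \<psi> (kron (proj x) (kron (proj y) (proj z)) *v \<psi>)
      = (\<Sum>r\<in>UNIV. cnj (\<psi> $ r) * (\<Sum>c\<in>UNIV. cnj (X r) * X c * \<psi> $ c))"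
    by (simp add: braket_def matrix_vector_mult_def)
  also have "\<dots> = trilin \<psi> x y z * cnj (trilin \<psi> x y z)"
    unfolding t by (simp add: sum_distrib_left sum_distrib_right mult_ac)
  also have "\<dots> = complex_of_real ((cmod (trilin \<psi> x y z))\<^sup>2)"
    by (simp only: complex_norm_square)
  finally show ?thesis by simp
qed

lemma bell_violating_imp_measurements:
  assumes "bell_violating \<psi>"
  shows "\<exists>A B C :: 2 \<Rightarrow> 2 \<Rightarrow> complex ^ 2 ^ 2.
    (\<forall>x. measurement (A x)) \<and> (\<forall>x. measurement (B x)) \<and> (\<forall>x. measurement (C x)) \<and>
    (let p = correlation \<psi> A B C in
      p (0,0,0) (0,0,0) - p (1,0,0) (1,0,0) - p (0,1,0) (0,1,0) - p (0,0,1) (0,0,1)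
        - p (0,0,0) (1,1,0) - p (0,0,0) (1,0,1) > 0)"
proof -
  obtain x x' y y' z z' where
    u: "norm x = 1" "norm x' = 1" "norm y = 1" "norm y' = 1" "norm z = 1" "norm z' = 1" and
    *: "(cmod (trilin \<psi> (perp x') y z))\<^sup>2 + (cmod (trilin \<psi> x (perp y') z))\<^sup>2
       + (cmod (trilin \<psi> x y (perp z')))\<^sup>2 + (cmod (trilin \<psi> x' y' z))\<^sup>2
       + (cmod (trilin \<psi> x' y z'))\<^sup>2 < (cmod (trilin \<psi> x y z))\<^sup>2"
    using assms unfolding bell_violating_def by blast
  define M :: "qubit \<Rightarrow> qubit \<Rightarrow> 2 \<Rightarrow> 2 \<Rightarrow> complex ^ 2 ^ 2" where
    "M p p' s = (let q = if s = 0 then p else p' in (\<lambda>a. if a = 0 then proj q else proj (perp q)))"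
    for p p' s
  have M: "\<forall>s. measurement (M p p' s)" if "norm p = 1" "norm p' = 1" for p p'
    using that by (simp add: M_def Let_def measurement_proj)
  have Mv: "M p p' 0 0 = proj p" "M p p' 1 0 = proj p'" "M p p' 1 1 = proj (perp p')" for p p'
    by (simp_all add: M_def)
  show ?thesis
    by (rule exI[of _ "M x x'"], rule exI[of _ "M y y'"], rule exI[of _ "M z z'"])
      (use * u in \<open>simp add: M Let_def correlation_def Mv braket_kron_proj\<close>)
qed

section \<open>Symmetries of the inequality: exchange of parties and local unitaries\<close>

text \<open>Exchanging the last two parties swaps p(010|010) with p(001|001) and p(000|110) with
  p(000|101).\<close>

lemma bell_violating_swap:
  assumes "bell_violating (\<chi> c. case c of (i, j, k) \<Rightarrow> \<psi> $ (i, k, j))"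
  shows "bell_violating \<psi>"
proof -
  have t: "trilin (\<chi> c. case c of (i, j, k) \<Rightarrow> \<psi> $ (i, k, j)) x y z = trilin \<psi> x z y" for x y z
    by (simp add: trilin_expand sum_2 algebra_simps)
  from assms obtain x x' y y' z z' where
    "norm x = 1" "norm x' = 1" "norm y = 1" "norm y' = 1" "norm z = 1" "norm z' = 1"
    "(cmod (trilin \<psi> (perp x') z y))\<^sup>2 + (cmod (trilin \<psi> x z (perp y')))\<^sup>2
       + (cmod (trilin \<psi> x (perp z') y))\<^sup>2 + (cmod (trilin \<psi> x' z y'))\<^sup>2
       + (cmod (trilin \<psi> x' z' y))\<^sup>2 < (cmod (trilin \<psi> x z y))\<^sup>2"
    unfolding bell_violating_def t by blast
  then show ?thesis
    unfolding bell_violating_def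
    by (intro exI[of _ x] exI[of _ x'] exI[of _ z] exI[of _ z'] exI[of _ y] exI[of _ y'])
      (simp add: add_ac)
qed

text \<open>For unit \<open>e\<close> this applies the SU(2) matrix with columns \<open>e\<close>
  and \<open>perp e\<close>. It commutes with the conjugate-linear map \<open>perp\<close>, so a
  change of basis respects the pairing of outcomes 0 and 1.\<close>

definition comb :: "qubit \<Rightarrow> qubit \<Rightarrow> qubit" where
  "comb e c = c $ 1 *s e + c $ 2 *s perp e"

lemma perp_comb: "perp (comb e c) = comb e (perp c)"
  by (simp add: vec_eq_iff forall_2 comb_def algebra_simps)

lemma norm_comb:
  assumes "norm e = 1"
  shows "norm (comb e c) = norm c"
proof -
  have "(norm (comb e c))\<^sup>2 = (norm e)\<^sup>2 * (norm c)\<^sup>2"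
    unfolding norm_qubit_sq of_real_eq_iff[where 'a = complex, symmetric]
    by (simp add: comb_def complex_norm_square of_real_add of_real_mult algebra_simps
        del: of_real_power)
  then show ?thesis
    using assms by (simp add: power2_eq_iff_nonneg)
qed

text \<open>The coefficients of the trilinear form of \<open>\<psi>\<close> in the local bases
  \<open>x, perp x\<close>, \<open>y, perp y\<close> and \<open>z, perp z\<close>.\<close>

definition rotate3 :: "qubit \<Rightarrow> qubit \<Rightarrow> qubit \<Rightarrow> qubits3 \<Rightarrow> qubits3" where
  "rotate3 x y z \<psi> = (\<chi> c. case c of (i, j, k) \<Rightarrow> trilin \<psi> (comb x (axis i 1)) (comb y (axis j 1)) (comb z (axis k 1)))"

lemma trilin_comb:
  "trilin \<psi> (comb e c) y z = c $ 1 * trilin \<psi> e y z + c $ 2 * trilin \<psi> (perp e) y z"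
  "trilin \<psi> x (comb e c) z = c $ 1 * trilin \<psi> x e z + c $ 2 * trilin \<psi> x (perp e) z"
  "trilin \<psi> x y (comb e c) = c $ 1 * trilin \<psi> x y e + c $ 2 * trilin \<psi> x y (perp e)"
  by (simp_all add: trilin_expand sum_2 comb_def algebra_simps)

lemma comb_axis [simp]: "comb e (axis 1 1) = e" "comb e (axis 2 1) = perp e"
  by (simp_all add: vec_eq_iff comb_def axis_def)

lemma rotate3_nth: "rotate3 x y z \<psi> $ (i, j, k)
    = trilin \<psi> (comb x (axis i 1)) (comb y (axis j 1)) (comb z (axis k 1))"
  by (simp add: rotate3_def)

lemma trilin_rotate3:
  "trilin (rotate3 x y z \<psi>) p q r = trilin \<psi> (comb x p) (comb y q) (comb z r)"
  unfolding trilin_expand[of "rotate3 x y z \<psi>"] rotate3_nth sum_2 comb_axis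
  unfolding trilin_comb by (simp add: algebra_simps)

text \<open>Since \<open>comb\<close> preserves norms and commutes with \<open>perp\<close>,
  applying it to the six vectors of a violation for the rotated state gives one for
  \<open>\<psi>\<close>.\<close>

lemma bell_violating_rotate3:
  assumes "bell_violating (rotate3 x y z \<psi>)" "norm x = 1" "norm y = 1" "norm z = 1"
  shows "bell_violating \<psi>"
proof -
  from assms(1) obtain p p' q q' r r' where
    "norm p = 1" "norm p' = 1" "norm q = 1" "norm q' = 1" "norm r = 1" "norm r' = 1"
    "(cmod (trilin \<psi> (perp (comb x p')) (comb y q) (comb z r)))\<^sup>2
     + (cmod (trilin \<psi> (comb x p) (perp (comb y q')) (comb z r)))\<^sup>2
     + (cmod (trilin \<psi> (comb x p) (comb y q) (perp (comb z r'))))\<^sup>2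
     + (cmod (trilin \<psi> (comb x p') (comb y q') (comb z r)))\<^sup>2
     + (cmod (trilin \<psi> (comb x p') (comb y q) (comb z r')))\<^sup>2
     < (cmod (trilin \<psi> (comb x p) (comb y q) (comb z r)))\<^sup>2"
    unfolding bell_violating_def trilin_rotate3 perp_comb by blast
  then show ?thesis
    unfolding bell_violating_def using norm_comb assms(2-4) by metis
qed

section \<open>Sufficient conditions for a violation\<close>

text \<open>Lagrange's identity, as \<open>dot x (perp v)\<close> is the determinant of
  \<open>conj v\<close> and \<open>x\<close>. Over the complex numbers it becomes a polynomial
  identity in the entries and their conjugates.\<close>

lemma dot_perp: "(cmod (dot x v))\<^sup>2 + (cmod (dot x (perp v)))\<^sup>2 = (norm x)\<^sup>2 * (norm v)\<^sup>2"
  unfolding norm_qubit_sq of_real_eq_iff[where 'a = complex, symmetric]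
  by (simp add: dot_def complex_norm_square of_real_add of_real_mult algebra_simps
      del: of_real_power)

lemma braket_self: "braket v v = complex_of_real ((norm v)\<^sup>2)"
  for v :: qubit
  unfolding norm_qubit_sq of_real_add complex_norm_square by (simp add: braket_qubit mult_ac)

lemma cnj_braket [simp]: "cnj (braket u v) = braket v u"
  by (simp add: braket_def mult.commute)

lemma norm_eq_1I: "(norm x)\<^sup>2 = 1 \<Longrightarrow> norm x = 1"
  by (metis norm_ge_zero power2_eq_iff_nonneg one_power2 zero_le_one)

text \<open>
  The second settings \<open>conj v\<close>, \<open>conj (T(x, -, z))\<close> and \<open>conj (T(x, y, -))\<close>, normalised, annihilate
  \<open>p(100|100)\<close>, \<open>p(010|010)\<close> and \<open>p(001|001)\<close>; the two fractions are the remaining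
  \<open>p(000|110)\<close> and \<open>p(000|101)\<close>.
\<close>

lemma bell_violating_criterion:
  fixes \<psi> :: qubits3 and x y z :: qubit
  defines "v \<equiv> contr \<psi> y z" and "w \<equiv> contr \<psi> (perp y) z" and "u \<equiv> contr \<psi> y (perp z)"
  assumes unit: "norm x = 1" "norm y = 1" "norm z = 1"
    and P: "dot x v \<noteq> 0"
    and less: "(cmod (cnj (dot x v) * braket v v + cnj (dot x w) * braket v w))\<^sup>2
           / (((cmod (dot x v))\<^sup>2 + (cmod (dot x w))\<^sup>2) * (norm v)\<^sup>2)
         + (cmod (cnj (dot x v) * braket v v + cnj (dot x u) * braket v u))\<^sup>2
           / (((cmod (dot x v))\<^sup>2 + (cmod (dot x u))\<^sup>2) * (norm v)\<^sup>2)
         < (cmod (dot x v))\<^sup>2"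
  shows "bell_violating \<psi>"
proof -
  define n where "n = norm v"
  have v0: "v \<noteq> 0" using P by (auto simp: dot_def)
  then have n: "n > 0" by (simp add: n_def)
  define N where "N t = sqrt ((cmod (dot x v))\<^sup>2 + (cmod (dot x t))\<^sup>2)" for t
  have N: "N t > 0" "(N t)\<^sup>2 = (cmod (dot x v))\<^sup>2 + (cmod (dot x t))\<^sup>2" for t
    using P by (auto simp: N_def add_pos_nonneg real_sqrt_pow2)
  define x' :: qubit where "x' = (\<chi> i. cnj (v $ i) / n)"
  \<comment> \<open>In the basis \<open>y, perp y\<close> the form \<open>T(x, -, z)\<close> has
    coordinates \<open>dot x v\<close> and \<open>dot x w\<close>. Their normalised conjugates are
    \<open>c w\<close>, so the second setting is \<open>comb y (c w)\<close>; likewise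
    \<open>comb z (c u)\<close> for the third party.\<close>
  define c :: "qubit \<Rightarrow> qubit" where
    "c t = vector [cnj (dot x v) / N t, cnj (dot x t) / N t]" for t
  have c: "c t $ 1 = cnj (dot x v) / N t" "c t $ 2 = cnj (dot x t) / N t" for t
    by (simp_all add: c_def)
  have nc: "norm (c t) = 1" for t
  proof -
    have "(norm (c t))\<^sup>2 = ((cmod (dot x v))\<^sup>2 + (cmod (dot x t))\<^sup>2) / (N t)\<^sup>2"
      using N(1)[of t] unfolding norm_qubit_sq by (simp add: c norm_divide power_divide add_divide_distrib)
    then have "(norm (c t))\<^sup>2 = 1" using N(1)[of t] by (simp flip: N(2))
    then show ?thesis by (rule norm_eq_1I)
  qed
  have x': "norm x' = 1"
  proof -
    have "(norm x')\<^sup>2 = (norm v)\<^sup>2 / n\<^sup>2"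
      using n unfolding norm_qubit_sq by (simp add: x'_def norm_divide power_divide add_divide_distrib)
    then have "(norm x')\<^sup>2 = 1" using n by (simp add: n_def)
    then show ?thesis by (rule norm_eq_1I)
  qed
  have lin: "trilin \<psi> p (comb y q) z = q $ 1 * dot p v + q $ 2 * dot p w"
    "trilin \<psi> p y (comb z q) = q $ 1 * dot p v + q $ 2 * dot p u" for p q
    by (simp_all add: trilin_eq_dot v_def w_def u_def contr_def dot_def sum_2 comb_def algebra_simps)
  have dx': "dot x' t = braket v t / n" for t
    by (simp add: dot_def x'_def braket_qubit add_divide_distrib)
  have dpx': "dot (perp x') v = 0"
    by (simp add: dot_def x'_def)
  have sq: "(cmod (c t $ 1 * dot x' v + c t $ 2 * dot x' t))\<^sup>2
      = (cmod (cnj (dot x v) * braket v v + cnj (dot x t) * braket v t))\<^sup>2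
           / (((cmod (dot x v))\<^sup>2 + (cmod (dot x t))\<^sup>2) * (norm v)\<^sup>2)" for t
  proof -
    have "c t $ 1 * dot x' v + c t $ 2 * dot x' t
        = (cnj (dot x v) * braket v v + cnj (dot x t) * braket v t) / (N t * n)"
      by (simp add: c dx' add_divide_distrib)
    then show ?thesis
      using N(1)[of t] n by (simp add: norm_divide norm_mult power_divide power_mult_distrib N(2) n_def)
  qed
  have k: "perp (c t) $ 1 * dot x v + perp (c t) $ 2 * dot x t = 0" for t
    by (simp add: c)
  show ?thesis
    unfolding bell_violating_def
  proof (intro exI conjI)
    show "(cmod (trilin \<psi> (perp x') y z))\<^sup>2 + (cmod (trilin \<psi> x (perp (comb y (c w))) z))\<^sup>2
       + (cmod (trilin \<psi> x y (perp (comb z (c u)))))\<^sup>2 + (cmod (trilin \<psi> x' (comb y (c w)) z))\<^sup>2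
       + (cmod (trilin \<psi> x' y (comb z (c u))))\<^sup>2 < (cmod (trilin \<psi> x y z))\<^sup>2"
      using less unfolding perp_comb lin sq k
      by (simp add: trilin_eq_dot dpx' flip: v_def)
  qed (simp_all add: unit x' norm_comb nc)
qed

text \<open>The solutions of \<open>dot x k = 0\<close> are the multiples of
  \<open>(- k $ 2, k $ 1)\<close>, whose pairing with \<open>v\<close> is the determinant assumed
  nonzero.\<close>

lemma exists_unit_dot_eq_0:
  assumes "k $ 1 * v $ 2 - k $ 2 * v $ 1 \<noteq> 0"
  shows "\<exists>x. norm x = 1 \<and> dot x k = 0 \<and> dot x v \<noteq> 0"
proof -
  have "norm k \<noteq> 0" using assms by auto
  define x :: qubit where "x = vector [- k $ 2 / norm k, k $ 1 / norm k]"
  have x: "x $ 1 = - k $ 2 / norm k" "x $ 2 = k $ 1 / norm k"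
    by (simp_all add: x_def)
  have "(norm x)\<^sup>2 = ((cmod (k $ 1))\<^sup>2 + (cmod (k $ 2))\<^sup>2) / (norm k)\<^sup>2"
    unfolding norm_qubit_sq[of x] by (simp add: x norm_divide power_divide add_divide_distrib)
  then have "(norm x)\<^sup>2 = 1" using \<open>norm k \<noteq> 0\<close> by (simp flip: norm_qubit_sq)
  then have "norm x = 1" by (rule norm_eq_1I)
  moreover have "dot x k = 0" by (simp add: dot_def x)
  moreover have "dot x v = (k $ 1 * v $ 2 - k $ 2 * v $ 1) / norm k"
    by (simp add: dot_def x diff_divide_distrib)
  ultimately show ?thesis using assms \<open>norm k \<noteq> 0\<close> by (intro exI[of _ x]) simp
qed

lemma contr_scale:
  "contr \<psi> (a *s y) (b *s z) = (a * b) *s contr \<psi> y z"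
  by (simp add: vec_eq_iff contr_def sum_2 algebra_simps)

lemma perp_scale: "perp (complex_of_real r *s y) = complex_of_real r *s perp y"
  by (simp add: vec_eq_iff forall_2)

lemma braket_scale: "braket (complex_of_real r *s u) (complex_of_real r *s v) = (complex_of_real r)\<^sup>2 * braket u v"
  for u v :: qubit
  by (simp add: braket_qubit algebra_simps power2_eq_square)

lemma norm_scale: "norm (complex_of_real r *s v) = \<bar>r\<bar> * norm v"
  for v :: qubit
  by (rule power2_eq_imp_eq)
    (simp_all add: norm_qubit_sq norm_mult power_mult_distrib algebra_simps)

lemma scale_unit:
  fixes y :: qubit
  assumes "y \<noteq> 0"
  obtains r :: real where "r > 0" "norm (complex_of_real r *s y) = 1"
  using assms by (intro that[of "1 / norm y"]) (simp_all only: norm_scale, simp_all)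

text \<open>Put P = |dot x v| and W = |dot x w|. With \<open>x\<close> making p(000|101) vanish and
  \<open>w\<close> orthogonal to \<open>v\<close>, the criterion reads P^2 |v|^2 / (P^2 + W^2) <
  P^2, that is |v|^2 < P^2 + W^2. Here |v|^2 = P^2 + |dot x (perp v)|^2, and the last term is less
  than W^2 because \<open>w\<close> is a longer vector along \<open>perp v\<close>.\<close>

lemma bell_violating_singular_unit:
  fixes \<psi> :: qubits3 and y z :: qubit
  defines "v \<equiv> contr \<psi> y z" and "w \<equiv> contr \<psi> (perp y) z" and "u \<equiv> contr \<psi> y (perp z)"
  assumes unit: "norm y = 1" "norm z = 1"
    and vw: "braket v w = 0" "norm v < norm w"
    and vu: "braket v u \<noteq> 0" "v $ 1 * u $ 2 - v $ 2 * u $ 1 \<noteq> 0"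
  shows "bell_violating \<psi>"
proof -
  \<comment> \<open>\<open>dot x k\<close> is the conjugate of the second numerator in the
    criterion.\<close>
  define k where "k = braket v v *s v + braket u v *s u"
  have "k $ 1 * v $ 2 - k $ 2 * v $ 1 = - (braket u v) * (v $ 1 * u $ 2 - v $ 2 * u $ 1)"
    by (simp add: k_def algebra_simps)
  moreover have "braket u v \<noteq> 0" using vu(1) cnj_braket[of u v] by fastforce
  ultimately have "k $ 1 * v $ 2 - k $ 2 * v $ 1 \<noteq> 0" using vu(2) by simp
  from exists_unit_dot_eq_0[OF this] obtain x where x: "norm x = 1" "dot x k = 0" "dot x v \<noteq> 0"
    by blast
  have PR: "dot x v * braket v v + dot x u * braket u v = 0"
    using x(2) by (simp add: k_def dot_def algebra_simps)
  then have "cnj (dot x v * braket v v + dot x u * braket u v) = 0" by simp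
  then have num2: "cnj (dot x v) * braket v v + cnj (dot x u) * braket v u = 0" by simp
  have v0: "norm v > 0" using x(3) by (auto simp: dot_def)
  \<comment> \<open>Up to \<open>q\<close>: \<open>w\<close> is a multiple of \<open>perp v\<close>
    by a factor of modulus |w| / |v|, obtained from the determinant of \<open>v\<close> and
    \<open>w\<close>.\<close>
  define \<delta> where "\<delta> = v $ 1 * w $ 2 - v $ 2 * w $ 1"
  have h: "(cmod (dot x v))\<^sup>2 + (cmod (dot x (perp v)))\<^sup>2 = (norm v)\<^sup>2"
    using dot_perp[of x v] x(1) by simp
  have "(cmod (braket v w))\<^sup>2 + (cmod \<delta>)\<^sup>2 = (norm v)\<^sup>2 * (norm w)\<^sup>2"
    using dot_perp[of w "\<chi> i. cnj (v $ i)"]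
    by (simp add: norm_qubit_sq dot_def braket_qubit \<delta>_def algebra_simps norm_minus_commute)
  then have d: "(cmod \<delta>)\<^sup>2 = (norm v)\<^sup>2 * (norm w)\<^sup>2" using vw by simp
  have "braket v v * dot x w - \<delta> * dot x (perp v) = braket v w * dot x v"
    by (simp add: dot_def \<delta>_def braket_qubit algebra_simps)
  then have "complex_of_real ((norm v)\<^sup>2) * dot x w = \<delta> * dot x (perp v)"
    using vw(1) by (simp add: braket_self)
  then have "(norm v)\<^sup>2 * cmod (dot x w) = cmod \<delta> * cmod (dot x (perp v))"
    by (metis norm_mult norm_of_real abs_power2)
  then have "((norm v)\<^sup>2)\<^sup>2 * (cmod (dot x w))\<^sup>2 = (norm v)\<^sup>2 * (norm w)\<^sup>2 * (cmod (dot x (perp v)))\<^sup>2"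
    by (metis power_mult_distrib d)
  then have q: "(norm v)\<^sup>2 * (cmod (dot x w))\<^sup>2 = (norm w)\<^sup>2 * (cmod (dot x (perp v)))\<^sup>2"
    using v0 by (simp add: power2_eq_square)
  \<comment> \<open>Otherwise \<open>x\<close> is parallel to \<open>conj v\<close>, and \<open>dot x k = 0\<close> reads \<open>\<parallel>v\<parallel>\<^sup>4 + \<bar>braket v u\<bar>\<^sup>2 = 0\<close>.\<close>
  have "dot x (perp v) \<noteq> 0"
  proof
    assume "dot x (perp v) = 0"
    moreover have "braket v v * dot x u = dot x v * braket v u + dot x (perp v) * (v $ 1 * u $ 2 - v $ 2 * u $ 1)"
      by (simp add: dot_def braket_qubit algebra_simps)
    ultimately have "braket v v * dot x u = dot x v * braket v u" by simp
    moreover have "dot x v * (braket v v)\<^sup>2 + (braket v v * dot x u) * braket u v = 0"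
      using arg_cong[OF PR, of "\<lambda>t. t * braket v v"] by (simp add: algebra_simps power2_eq_square)
    ultimately have "dot x v * ((braket v v)\<^sup>2 + braket v u * cnj (braket v u)) = 0"
      by (simp add: algebra_simps)
    then have "(braket v v)\<^sup>2 + braket v u * cnj (braket v u) = 0" using x(3) by simp
    then have "complex_of_real (((norm v)\<^sup>2)\<^sup>2 + (cmod (braket v u))\<^sup>2) = 0"
      by (simp only: of_real_add complex_norm_square[of "braket v u"] braket_self of_real_power flip: of_real_power)
    then have "((norm v)\<^sup>2)\<^sup>2 + (cmod (braket v u))\<^sup>2 = 0" using of_real_eq_0_iff by blast
    moreover have "((norm v)\<^sup>2)\<^sup>2 + (cmod (braket v u))\<^sup>2 > 0"
      using v0 by (intro add_pos_nonneg) simp_all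
    ultimately show False by simp
  qed
  moreover have "(norm v)\<^sup>2 < (norm w)\<^sup>2" using vw(2) by (simp add: power_strict_mono)
  ultimately have "(norm v)\<^sup>2 * (cmod (dot x (perp v)))\<^sup>2 < (norm v)\<^sup>2 * (cmod (dot x w))\<^sup>2"
    unfolding q by simp
  then have "(cmod (dot x (perp v)))\<^sup>2 < (cmod (dot x w))\<^sup>2" using v0 by simp
  with h have less: "(norm v)\<^sup>2 < (cmod (dot x v))\<^sup>2 + (cmod (dot x w))\<^sup>2" by linarith
  have norm_v: "cmod (braket v v) = (norm v)\<^sup>2"
    unfolding braket_self norm_of_real by simp
  have "(cmod (dot x v))\<^sup>2 * ((norm v)\<^sup>2 * (norm v)\<^sup>2)
      < (cmod (dot x v))\<^sup>2 * (((cmod (dot x v))\<^sup>2 + (cmod (dot x w))\<^sup>2) * (norm v)\<^sup>2)"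
    by (intro mult_strict_left_mono mult_strict_right_mono less) (use v0 x(3) in simp_all)
  then have "(cmod (cnj (dot x v) * braket v v))\<^sup>2
      / (((cmod (dot x v))\<^sup>2 + (cmod (dot x w))\<^sup>2) * (norm v)\<^sup>2) < (cmod (dot x v))\<^sup>2"
    using v0 less
    by (subst pos_divide_less_eq)
      (auto simp: norm_v norm_mult power_mult_distrib power2_eq_square[of "(norm v)\<^sup>2"]
         intro!: mult_pos_pos intro: less_trans[of 0 "(norm v)\<^sup>2"])
  then show ?thesis
    using unit x vw(1) num2 unfolding v_def w_def u_def
    by (intro bell_violating_criterion[of x y z]) simp_all
qed

text \<open>For \<open>u = - w\<close> the two numerators of the criterion coincide, so one choice
  of \<open>x\<close> annihilates both.\<close>

lemma bell_violating_opposite_unit: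
  fixes \<psi> :: qubits3 and y z :: qubit
  defines "v \<equiv> contr \<psi> y z" and "w \<equiv> contr \<psi> (perp y) z" and "u \<equiv> contr \<psi> y (perp z)"
  assumes unit: "norm y = 1" "norm z = 1"
    and uw: "u = - w" "braket v w \<noteq> 0" "v $ 1 * w $ 2 - v $ 2 * w $ 1 \<noteq> 0"
  shows "bell_violating \<psi>"
proof -
  define k where "k = braket v v *s v + braket w v *s w"
  have "k $ 1 * v $ 2 - k $ 2 * v $ 1 = - (braket w v) * (v $ 1 * w $ 2 - v $ 2 * w $ 1)"
    by (simp add: k_def algebra_simps)
  moreover have "braket w v \<noteq> 0" using uw(2) cnj_braket[of w v] by fastforce
  ultimately have "k $ 1 * v $ 2 - k $ 2 * v $ 1 \<noteq> 0" using uw(3) by simp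
  from exists_unit_dot_eq_0[OF this] obtain x where x: "norm x = 1" "dot x k = 0" "dot x v \<noteq> 0"
    by blast
  have "dot x v * braket v v + dot x w * braket w v = 0"
    using x(2) by (simp add: k_def dot_def algebra_simps)
  then have "cnj (dot x v * braket v v + dot x w * braket w v) = 0" by simp
  then have 1: "cnj (dot x v) * braket v v + cnj (dot x w) * braket v w = 0" by simp
  moreover have "cnj (dot x u) * braket v u = cnj (dot x w) * braket v w"
    unfolding uw(1) by (simp add: dot_def braket_qubit algebra_simps)
  ultimately have 2: "cnj (dot x v) * braket v v + cnj (dot x u) * braket v u = 0" by simp
  show ?thesis
    by (rule bell_violating_criterion[of x y z])
      (use unit x 1 2 in \<open>simp_all flip: v_def w_def u_def\<close>)
qed

text \<open>Positive real factors on \<open>y\<close> and \<open>z\<close> scale \<open>v\<close>,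
  \<open>w\<close> and \<open>u\<close> by one common factor, so the conditions do not depend on
  normalisation.\<close>

lemma bell_violating_singular:
  fixes \<psi> :: qubits3 and y z :: qubit
  defines "v \<equiv> contr \<psi> y z" and "w \<equiv> contr \<psi> (perp y) z" and "u \<equiv> contr \<psi> y (perp z)"
  assumes nz: "y \<noteq> 0" "z \<noteq> 0"
    and vw: "braket v w = 0" "norm v < norm w"
    and vu: "braket v u \<noteq> 0" "v $ 1 * u $ 2 - v $ 2 * u $ 1 \<noteq> 0"
  shows "bell_violating \<psi>"
proof -
  obtain r s where r: "r > 0" "norm (complex_of_real r *s y) = 1"
    and s: "s > 0" "norm (complex_of_real s *s z) = 1"
    using scale_unit[OF nz(1)] scale_unit[OF nz(2)] by metis
  define l where "l = r * s"
  have l: "complex_of_real r * complex_of_real s = complex_of_real l" "l > 0"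
    using r s by (simp_all add: l_def)
  have "(complex_of_real l *s v) $ 1 * (complex_of_real l *s u) $ 2
      - (complex_of_real l *s v) $ 2 * (complex_of_real l *s u) $ 1
      = (complex_of_real l)\<^sup>2 * (v $ 1 * u $ 2 - v $ 2 * u $ 1)"
    by (simp add: algebra_simps power2_eq_square)
  also have "\<dots> \<noteq> 0" using l(2) vu(2) by simp
  finally show ?thesis
    using vw vu l r s unfolding v_def w_def u_def
    by (intro bell_violating_singular_unit[of "complex_of_real r *s y" "complex_of_real s *s z"])
      (simp_all only: perp_scale contr_scale l braket_scale norm_scale, simp_all)
qed

lemma bell_violating_opposite:
  fixes \<psi> :: qubits3 and y z :: qubit
  defines "v \<equiv> contr \<psi> y z" and "w \<equiv> contr \<psi> (perp y) z" and "u \<equiv> contr \<psi> y (perp z)"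
  assumes nz: "y \<noteq> 0" "z \<noteq> 0"
    and uw: "u = - w" "braket v w \<noteq> 0" "v $ 1 * w $ 2 - v $ 2 * w $ 1 \<noteq> 0"
  shows "bell_violating \<psi>"
proof -
  obtain r s where r: "r > 0" "norm (complex_of_real r *s y) = 1"
    and s: "s > 0" "norm (complex_of_real s *s z) = 1"
    using scale_unit[OF nz(1)] scale_unit[OF nz(2)] by metis
  define l where "l = r * s"
  have l: "complex_of_real r * complex_of_real s = complex_of_real l" "l > 0"
    using r s by (simp_all add: l_def)
  have "(complex_of_real l *s v) $ 1 * (complex_of_real l *s w) $ 2
      - (complex_of_real l *s v) $ 2 * (complex_of_real l *s w) $ 1
      = (complex_of_real l)\<^sup>2 * (v $ 1 * w $ 2 - v $ 2 * w $ 1)"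
    by (simp add: algebra_simps power2_eq_square)
  also have "\<dots> \<noteq> 0" using l(2) uw(3) by simp
  finally show ?thesis
    using uw l r s unfolding v_def w_def u_def
    by (intro bell_violating_opposite_unit[of "complex_of_real r *s y" "complex_of_real s *s z"])
      (simp_all only: perp_scale contr_scale l braket_scale, simp_all add: vec_eq_iff)
qed

section \<open>States with a vanishing partial contraction\<close>

text \<open>At \<open>y = z = (1, 0)\<close> one has \<open>v = 0\<close> and
  \<open>w = (\<omega>, 0)\<close>. Nearby, \<open>v\<close> stays shorter than \<open>w\<close>,
  and \<open>y\<close> is tuned to make them orthogonal; the conditions on \<open>u0\<close>,
  \<open>u1\<close>, \<open>b\<close> keep \<open>u\<close> neither parallel nor orthogonal to
  \<open>v\<close>.\<close>

lemma bell_violating_normal_form: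
  fixes \<psi> :: qubits3 and u0 u1 a b \<omega> :: complex
  assumes \<psi>: "\<psi> $ (1, 1, 1) = 0" "\<psi> $ (2, 1, 1) = 0" "\<psi> $ (1, 2, 1) = \<omega>" "\<psi> $ (2, 2, 1) = 0"
    "\<psi> $ (1, 1, 2) = u0" "\<psi> $ (2, 1, 2) = u1" "\<psi> $ (1, 2, 2) = a" "\<psi> $ (2, 2, 2) = b"
    and nz: "\<omega> \<noteq> 0" "u1 \<noteq> 0 \<or> b \<noteq> 0" "u0 \<noteq> 0 \<or> u1 \<noteq> 0 \<and> b \<noteq> 0"
  shows "bell_violating \<psi>"
proof -
  \<comment> \<open>For \<open>y = (1, t)\<close> and \<open>z = (1, \<epsilon>)\<close> the condition \<open>braket v w = 0\<close> is a quadratic equation in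
    \<open>\<tau> = t / \<epsilon>\<close>, see \<open>quad\<close> below; its discriminant is a nonnegative real number, and \<open>\<tau>\<close> is the
    root that stays bounded as \<open>\<epsilon>\<close> tends to 0.\<close>
  define F where "F = at_right (0 :: real)"
  define m where "m \<epsilon> = \<omega> + complex_of_real \<epsilon> * a" for \<epsilon>
  define c where "c \<epsilon> = cnj u0 * m \<epsilon> + complex_of_real \<epsilon> * cnj u1 * b" for \<epsilon>
  define D where "D \<epsilon> = (cmod (m \<epsilon>))\<^sup>2 + \<epsilon>\<^sup>2 * ((cmod b)\<^sup>2 - (cmod u0)\<^sup>2 - (cmod u1)\<^sup>2)" for \<epsilon>
  define S where "S \<epsilon> = sqrt ((D \<epsilon>)\<^sup>2 + 4 * \<epsilon>\<^sup>2 * (cmod (c \<epsilon>))\<^sup>2)" for \<epsilon>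
  \<comment> \<open>The root is written with \<open>D + S\<close> in the denominator because the
    leading coefficient of the quadratic tends to 0. The conjugate appears since \<open>quad\<close>
    is an equation for \<open>cnj (\<tau> \<epsilon>)\<close>.\<close>
  define \<tau> where "\<tau> \<epsilon> = - 2 * cnj (c \<epsilon>) / complex_of_real (D \<epsilon> + S \<epsilon>)" for \<epsilon>
  define t where "t \<epsilon> = complex_of_real \<epsilon> * \<tau> \<epsilon>" for \<epsilon>
  define y :: "real \<Rightarrow> qubit" where "y \<epsilon> = vector [1, t \<epsilon>]" for \<epsilon>
  define z :: "real \<Rightarrow> qubit" where "z \<epsilon> = vector [1, complex_of_real \<epsilon>]" for \<epsilon>
  define v where "v \<epsilon> = contr \<psi> (y \<epsilon>) (z \<epsilon>)" for \<epsilon>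
  define w where "w \<epsilon> = contr \<psi> (perp (y \<epsilon>)) (z \<epsilon>)" for \<epsilon>
  define u where "u \<epsilon> = contr \<psi> (y \<epsilon>) (perp (z \<epsilon>))" for \<epsilon>

  have v: "v \<epsilon> $ 1 = complex_of_real \<epsilon> * u0 + t \<epsilon> * m \<epsilon>" "v \<epsilon> $ 2 = complex_of_real \<epsilon> * (u1 + t \<epsilon> * b)"
    and w: "w \<epsilon> $ 1 = m \<epsilon> - cnj (t \<epsilon>) * complex_of_real \<epsilon> * u0"
      "w \<epsilon> $ 2 = complex_of_real \<epsilon> * (b - cnj (t \<epsilon>) * u1)"
    and u: "u \<epsilon> $ 1 = u0 + t \<epsilon> * (a - complex_of_real \<epsilon> * \<omega>)" "u \<epsilon> $ 2 = u1 + t \<epsilon> * b" for \<epsilon>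
    by (simp_all add: v_def w_def u_def contr_def sum_2 \<psi> y_def z_def m_def algebra_simps)

  have e0: "((\<lambda>\<epsilon>. \<epsilon>) \<longlongrightarrow> 0) F" and e: "(complex_of_real \<longlongrightarrow> 0) F"
    using tendsto_of_real[OF tendsto_ident_at[of 0 "{0<..}"], where 'a = complex]
    by (simp_all add: F_def)
  have m_lim: "(m \<longlongrightarrow> \<omega>) F"
    unfolding m_def by (rule tendsto_eq_intros refl e | simp)+
  have c_lim: "(c \<longlongrightarrow> cnj u0 * \<omega>) F"
    unfolding c_def by (rule tendsto_eq_intros refl e m_lim | simp)+
  have D_lim: "(D \<longlongrightarrow> (cmod \<omega>)\<^sup>2) F"
    unfolding D_def by (rule tendsto_eq_intros refl e0 m_lim | simp)+
  have "(S \<longlongrightarrow> sqrt (((cmod \<omega>)\<^sup>2)\<^sup>2)) F"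
    unfolding S_def by (rule tendsto_eq_intros refl e0 D_lim c_lim | simp)+
  then have S_lim: "(S \<longlongrightarrow> (cmod \<omega>)\<^sup>2) F"
    by (simp only: real_sqrt_abs abs_power2)
  have "(\<tau> \<longlongrightarrow> - 2 * cnj (cnj u0 * \<omega>) / complex_of_real ((cmod \<omega>)\<^sup>2 + (cmod \<omega>)\<^sup>2)) F"
    unfolding \<tau>_def using nz(1) by (intro tendsto_intros c_lim D_lim S_lim) simp
  also have "- 2 * cnj (cnj u0 * \<omega>) / complex_of_real ((cmod \<omega>)\<^sup>2 + (cmod \<omega>)\<^sup>2) = - u0 / \<omega>"
    using nz(1) unfolding of_real_add complex_norm_square by (simp add: field_simps)
  finally have \<tau>_lim: "(\<tau> \<longlongrightarrow> - u0 / \<omega>) F" .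
  have t_lim: "(t \<longlongrightarrow> 0) F"
    unfolding t_def by (rule tendsto_eq_intros refl e \<tau>_lim | simp)+
  have v1_lim: "((\<lambda>\<epsilon>. v \<epsilon> $ 1) \<longlongrightarrow> 0) F" and v2_lim: "((\<lambda>\<epsilon>. v \<epsilon> $ 2) \<longlongrightarrow> 0) F"
    and w1_lim: "((\<lambda>\<epsilon>. w \<epsilon> $ 1) \<longlongrightarrow> \<omega>) F" and w2_lim: "((\<lambda>\<epsilon>. w \<epsilon> $ 2) \<longlongrightarrow> 0) F"
    and u1_lim: "((\<lambda>\<epsilon>. u \<epsilon> $ 1) \<longlongrightarrow> u0) F" and u2_lim: "((\<lambda>\<epsilon>. u \<epsilon> $ 2) \<longlongrightarrow> u1) F"
    unfolding v w u by (rule tendsto_eq_intros refl e t_lim m_lim | simp)+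

  have ev_e: "\<forall>\<^sub>F \<epsilon> in F. \<epsilon> > 0"
    unfolding F_def by (rule eventually_at_right_less)
  have ev_D: "\<forall>\<^sub>F \<epsilon> in F. D \<epsilon> > 0"
    using order_tendstoD(1)[OF D_lim, of 0] nz(1) by simp
  have ev_c: "\<forall>\<^sub>F \<epsilon> in F. c \<epsilon> \<noteq> 0"
  proof (cases "u0 = 0")
    case True
    \<comment> \<open>The limit of \<open>c\<close> is 0 here, but \<open>c\<close> is a nonzero
      multiple of \<open>\<epsilon>\<close>.\<close>
    then have "u1 \<noteq> 0" "b \<noteq> 0" using nz(3) by auto
    then have "c \<epsilon> \<noteq> 0" if "\<epsilon> > 0" for \<epsilon>
      using that by (simp add: c_def True)
    with ev_e show ?thesis by (rule eventually_mono)
  next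
    case False
    then show ?thesis using tendsto_imp_eventually_ne[OF c_lim] nz(1) by simp
  qed
  have ev_less: "\<forall>\<^sub>F \<epsilon> in F. (norm (v \<epsilon>))\<^sup>2 < (norm (w \<epsilon>))\<^sup>2"
  proof -
    have "((\<lambda>\<epsilon>. (norm (w \<epsilon>))\<^sup>2 - (norm (v \<epsilon>))\<^sup>2) \<longlongrightarrow> ((cmod \<omega>)\<^sup>2 + (cmod 0)\<^sup>2) - ((cmod 0)\<^sup>2 + (cmod 0)\<^sup>2)) F"
      unfolding norm_qubit_sq
      by (intro tendsto_diff tendsto_add tendsto_power tendsto_norm v1_lim v2_lim w1_lim w2_lim)
    from order_tendstoD(1)[OF this, of 0] nz(1) show ?thesis by simp
  qed
  have ev_u: "\<forall>\<^sub>F \<epsilon> in F. u \<epsilon> $ 2 \<noteq> 0 \<and> w \<epsilon> $ 1 * u \<epsilon> $ 2 - w \<epsilon> $ 2 * u \<epsilon> $ 1 \<noteq> 0"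
  proof (cases "u1 = 0")
    case True
    then have nz': "u0 \<noteq> 0" "b \<noteq> 0" using nz by auto
    \<comment> \<open>Both quantities tend to 0 here. After the factor \<open>\<epsilon> * b\<close>
      is taken out, their limits are \<open>- u0 / \<omega>\<close> and
      \<open>- 2 * u0\<close>.\<close>
    have "((\<lambda>\<epsilon>. w \<epsilon> $ 1 * \<tau> \<epsilon> - u \<epsilon> $ 1) \<longlongrightarrow> \<omega> * (- u0 / \<omega>) - u0) F"
      by (intro tendsto_diff tendsto_mult w1_lim \<tau>_lim u1_lim)
    then have "\<forall>\<^sub>F \<epsilon> in F. w \<epsilon> $ 1 * \<tau> \<epsilon> - u \<epsilon> $ 1 \<noteq> 0"
      by (rule tendsto_imp_eventually_ne) (use nz nz' in simp)
    moreover have "\<forall>\<^sub>F \<epsilon> in F. \<tau> \<epsilon> \<noteq> 0"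
      using \<tau>_lim by (rule tendsto_imp_eventually_ne) (use nz nz' in simp)
    ultimately show ?thesis using ev_e
    proof eventually_elim
      case (elim \<epsilon>)
      have "w \<epsilon> $ 1 * u \<epsilon> $ 2 - w \<epsilon> $ 2 * u \<epsilon> $ 1 = complex_of_real \<epsilon> * b * (w \<epsilon> $ 1 * \<tau> \<epsilon> - u \<epsilon> $ 1)"
        by (simp add: w(2) u(2) True t_def algebra_simps)
      then show ?case using elim nz' by (simp add: u(2) True t_def)
    qed
  next
    case False
    have "\<forall>\<^sub>F \<epsilon> in F. u \<epsilon> $ 2 \<noteq> 0"
      using tendsto_imp_eventually_ne[OF u2_lim False] .
    moreover have "((\<lambda>\<epsilon>. w \<epsilon> $ 1 * u \<epsilon> $ 2 - w \<epsilon> $ 2 * u \<epsilon> $ 1) \<longlongrightarrow> \<omega> * u1 - 0 * u0) F"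
      by (intro tendsto_diff tendsto_mult w1_lim w2_lim u1_lim u2_lim)
    then have "\<forall>\<^sub>F \<epsilon> in F. w \<epsilon> $ 1 * u \<epsilon> $ 2 - w \<epsilon> $ 2 * u \<epsilon> $ 1 \<noteq> 0"
      by (rule tendsto_imp_eventually_ne) (use nz False in simp)
    ultimately show ?thesis by eventually_elim simp
  qed

  have "\<forall>\<^sub>F \<epsilon> in F. \<epsilon> > 0 \<and> D \<epsilon> > 0 \<and> c \<epsilon> \<noteq> 0 \<and> (norm (v \<epsilon>))\<^sup>2 < (norm (w \<epsilon>))\<^sup>2 \<and>
      u \<epsilon> $ 2 \<noteq> 0 \<and> w \<epsilon> $ 1 * u \<epsilon> $ 2 - w \<epsilon> $ 2 * u \<epsilon> $ 1 \<noteq> 0"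
    using ev_e ev_D ev_c ev_less ev_u by eventually_elim simp
  moreover have "F \<noteq> bot" by (simp add: F_def)
  ultimately obtain \<epsilon> where \<epsilon>: "\<epsilon> > 0" "D \<epsilon> > 0" "c \<epsilon> \<noteq> 0" "(norm (v \<epsilon>))\<^sup>2 < (norm (w \<epsilon>))\<^sup>2"
    "u \<epsilon> $ 2 \<noteq> 0" "w \<epsilon> $ 1 * u \<epsilon> $ 2 - w \<epsilon> $ 2 * u \<epsilon> $ 1 \<noteq> 0"
    using eventually_happens' by blast

  define e where "e = complex_of_real \<epsilon>"
  have S: "S \<epsilon> \<ge> 0" "(S \<epsilon>)\<^sup>2 = (D \<epsilon>)\<^sup>2 + 4 * \<epsilon>\<^sup>2 * (cmod (c \<epsilon>))\<^sup>2"
    by (simp_all add: S_def)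
  have pos: "D \<epsilon> + S \<epsilon> > 0" using S(1) \<epsilon>(2) by simp
  have "\<tau> \<epsilon> \<noteq> 0" using pos \<epsilon>(3) by (simp add: \<tau>_def del: of_real_add)
  then have t: "t \<epsilon> \<noteq> 0" using \<epsilon>(1) by (simp add: t_def)
  have quad: "c \<epsilon> + cnj (\<tau> \<epsilon>) * complex_of_real (D \<epsilon>) - e\<^sup>2 * (cnj (\<tau> \<epsilon>))\<^sup>2 * cnj (c \<epsilon>) = 0"
  proof -
    define d s where "d = complex_of_real (D \<epsilon>)" and "s = complex_of_real (S \<epsilon>)"
    have ds: "d + s \<noteq> 0" using pos unfolding d_def s_def by (simp flip: of_real_add)
    have "complex_of_real ((S \<epsilon>)\<^sup>2) = complex_of_real ((D \<epsilon>)\<^sup>2 + 4 * \<epsilon>\<^sup>2 * (cmod (c \<epsilon>))\<^sup>2)"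
      by (simp only: S(2))
    then have s2: "s\<^sup>2 = d\<^sup>2 + 4 * e\<^sup>2 * (c \<epsilon> * cnj (c \<epsilon>))"
      unfolding of_real_add of_real_mult complex_norm_square by (simp add: s_def d_def e_def)
    have \<tau>: "cnj (\<tau> \<epsilon>) * (d + s) = - 2 * c \<epsilon>"
      using ds by (simp add: \<tau>_def s_def d_def)
    have "(c \<epsilon> + cnj (\<tau> \<epsilon>) * d - e\<^sup>2 * (cnj (\<tau> \<epsilon>))\<^sup>2 * cnj (c \<epsilon>)) * (d + s)\<^sup>2
        = c \<epsilon> * (d + s)\<^sup>2 + (cnj (\<tau> \<epsilon>) * (d + s)) * d * (d + s) - e\<^sup>2 * (cnj (\<tau> \<epsilon>) * (d + s))\<^sup>2 * cnj (c \<epsilon>)"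
      by (simp add: power2_eq_square algebra_simps)
    also have "\<dots> = c \<epsilon> * (s\<^sup>2 - (d\<^sup>2 + 4 * e\<^sup>2 * (c \<epsilon> * cnj (c \<epsilon>))))"
      unfolding \<tau> by (simp add: power2_eq_square algebra_simps)
    also have "\<dots> = 0" by (simp add: s2)
    finally show ?thesis using ds by (simp add: d_def)
  qed
  have D: "complex_of_real (D \<epsilon>) = m \<epsilon> * cnj (m \<epsilon>) + e\<^sup>2 * (b * cnj b - u0 * cnj u0 - u1 * cnj u1)"
    unfolding D_def of_real_add of_real_mult of_real_diff complex_norm_square by (simp add: e_def)
  have e: "complex_of_real \<epsilon> = e" "cnj e = e" by (simp_all add: e_def)
  have "braket (v \<epsilon>) (w \<epsilon>)
      = e * (c \<epsilon> + cnj (\<tau> \<epsilon>) * complex_of_real (D \<epsilon>) - e\<^sup>2 * (cnj (\<tau> \<epsilon>))\<^sup>2 * cnj (c \<epsilon>))"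
    unfolding D by (simp add: braket_qubit v w t_def c_def e power2_eq_square algebra_simps)
  then have vw: "braket (v \<epsilon>) (w \<epsilon>) = 0" by (simp add: quad)

  \<comment> \<open>As \<open>z - e * perp z = (1 + e^2, 0)\<close>, the vector
    \<open>v - e * u\<close> equals \<open>(t * \<omega> * (1 + e^2), 0)\<close>.\<close>
  have "v \<epsilon> $ 1 * u \<epsilon> $ 2 - v \<epsilon> $ 2 * u \<epsilon> $ 1 = t \<epsilon> * \<omega> * (1 + e\<^sup>2) * u \<epsilon> $ 2"
    by (simp add: v u e m_def power2_eq_square algebra_simps)
  moreover have "1 + e\<^sup>2 \<noteq> 0"
  proof -
    have "1 + \<epsilon>\<^sup>2 \<noteq> 0" by (metis add_pos_nonneg less_irrefl zero_le_power2 zero_less_one)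
    then show ?thesis unfolding e_def by (metis of_real_1 of_real_add of_real_eq_0_iff of_real_power)
  qed
  ultimately have det: "v \<epsilon> $ 1 * u \<epsilon> $ 2 - v \<epsilon> $ 2 * u \<epsilon> $ 1 \<noteq> 0"
    using t nz(1) \<epsilon>(5) by simp

  \<comment> \<open>Since \<open>w\<close> spans the orthogonal complement of \<open>v\<close>,
    non-orthogonality of \<open>v\<close> and \<open>u\<close> follows from independence of
    \<open>w\<close> and \<open>u\<close>.\<close>
  have "w \<epsilon> $ 1 * braket (v \<epsilon>) (u \<epsilon>)
      = cnj (v \<epsilon> $ 2) * (w \<epsilon> $ 1 * u \<epsilon> $ 2 - w \<epsilon> $ 2 * u \<epsilon> $ 1) + u \<epsilon> $ 1 * braket (v \<epsilon>) (w \<epsilon>)"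
    by (simp add: braket_qubit algebra_simps)
  moreover have "v \<epsilon> $ 2 \<noteq> 0" using \<epsilon>(1,5) by (simp add: v(2) u(2))
  ultimately have vu: "braket (v \<epsilon>) (u \<epsilon>) \<noteq> 0" using vw \<epsilon>(6) by auto

  have "y \<epsilon> $ 1 \<noteq> 0" "z \<epsilon> $ 1 \<noteq> 0" by (simp_all add: y_def z_def)
  then have "y \<epsilon> \<noteq> 0" "z \<epsilon> \<noteq> 0" by auto
  moreover have "norm (v \<epsilon>) < norm (w \<epsilon>)" using \<epsilon>(4) by (simp add: power_less_imp_less_base)
  ultimately show ?thesis
    using vw vu det unfolding v_def w_def u_def by (intro bell_violating_singular)
qed

text \<open>The perturbation above fails here: \<open>u0 = b = 0\<close> gives \<open>c = 0\<close>,
  hence \<open>t = 0\<close> and \<open>u\<close> parallel to \<open>v\<close>. Instead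
  \<open>y = (r, 1)\<close> and \<open>z = (1, r)\<close> achieve \<open>u = - w\<close>.\<close>

lemma bell_violating_GHZ:
  fixes \<psi> :: qubits3
  assumes \<psi>: "\<psi> $ (1, 1, 1) = 0" "\<psi> $ (2, 1, 1) = 0" "\<psi> $ (1, 2, 1) = \<omega>" "\<psi> $ (2, 2, 1) = 0"
    "\<psi> $ (1, 1, 2) = 0" "\<psi> $ (2, 1, 2) = \<mu>" "\<psi> $ (1, 2, 2) = 0" "\<psi> $ (2, 2, 2) = 0"
    and nz: "\<omega> \<noteq> 0" "\<mu> \<noteq> 0"
  shows "bell_violating \<psi>"
proof -
  \<comment> \<open>\<open>braket v w\<close> is \<open>r * (|\<omega>|^2 - r^2 |\<mu>|^2)\<close>,
    so \<open>r = 1\<close> fails only for equal moduli.\<close>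
  define r :: real where "r = (if cmod \<omega> = cmod \<mu> then 2 else 1)"
  have r: "r > 0" "r * ((cmod \<omega>)\<^sup>2 - r\<^sup>2 * (cmod \<mu>)\<^sup>2) \<noteq> 0"
    using nz by (auto simp: r_def power2_eq_iff_nonneg)
  define y :: qubit where "y = vector [complex_of_real r, 1]"
  define z :: qubit where "z = vector [1, complex_of_real r]"
  define v where "v = contr \<psi> y z"
  define w where "w = contr \<psi> (perp y) z"
  have v: "v $ 1 = \<omega>" "v $ 2 = \<mu> * (complex_of_real r)\<^sup>2"
    and w: "w $ 1 = \<omega> * complex_of_real r" "w $ 2 = - \<mu> * complex_of_real r"
    by (simp_all add: v_def w_def contr_def sum_2 \<psi> y_def z_def power2_eq_square)
  have opp: "contr \<psi> y (perp z) = - w"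
    by (simp add: vec_eq_iff forall_2 w) (simp add: contr_def sum_2 \<psi> y_def z_def)
  have "braket v w = complex_of_real (r * ((cmod \<omega>)\<^sup>2 - r\<^sup>2 * (cmod \<mu>)\<^sup>2))"
    unfolding of_real_mult of_real_diff complex_norm_square
    by (simp add: braket_qubit v w power2_eq_square algebra_simps)
  then have 1: "braket v w \<noteq> 0" using r(2) of_real_eq_0_iff by metis
  have "v $ 1 * w $ 2 - v $ 2 * w $ 1 = complex_of_real (- (r * (1 + r\<^sup>2))) * (\<omega> * \<mu>)"
    by (simp add: v w power2_eq_square algebra_simps)
  moreover have "r * (1 + r\<^sup>2) \<noteq> 0" using r(1) by (simp add: add_pos_pos less_imp_neq[symmetric])
  ultimately have 2: "v $ 1 * w $ 2 - v $ 2 * w $ 1 \<noteq> 0" using nz by (metis mult_eq_0_iff neg_equal_0_iff_equal of_real_eq_0_iff)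
  have "y $ 2 \<noteq> 0" "z $ 1 \<noteq> 0" by (simp_all add: y_def z_def)
  then have "y \<noteq> 0" "z \<noteq> 0" by auto
  with opp 1 2 show ?thesis unfolding v_def w_def by (intro bell_violating_opposite)
qed

section \<open>Reduction of entangled states\<close>

lemma comb_surj:
  assumes "norm e = 1"
  shows "y = comb e (\<chi> i. if i = 1 then braket e y else braket (perp e) y)"
proof -
  have "braket e e = 1" using assms by (simp add: braket_self)
  then have n: "cnj (e $ 1) * e $ 1 + cnj (e $ 2) * e $ 2 = 1" by (simp add: braket_qubit)
  have "comb e (\<chi> i. if i = 1 then braket e y else braket (perp e) y)
    = (cnj (e $ 1) * e $ 1 + cnj (e $ 2) * e $ 2) *s y"
    by (simp add: vec_eq_iff forall_2 comb_def braket_qubit algebra_simps)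
  then show ?thesis by (simp add: n)
qed

lemma trilin_axis: "trilin \<psi> (axis i 1) (axis j 1) (axis k 1) = \<psi> $ (i, j, k)"
  by (simp add: trilin_expand axis_def if_distrib[of "\<lambda>x. _ * x"] if_distrib[of "\<lambda>x. x * _"]
      cong: if_cong)

section \<open>Vanishing contractions and biseparability\<close>

lemma norm_vec_sq: "(norm (v :: complex ^ 'n))\<^sup>2 = (\<Sum>i\<in>UNIV. (cmod (v $ i))\<^sup>2)"
  by (simp add: norm_vec_def L2_set_def sum_nonneg)

lemma sum_qubits2: "sum f (UNIV :: (2 \<times> 2) set) = (\<Sum>j\<in>UNIV. \<Sum>k\<in>UNIV. f (j, k))"
  by (simp add: sum.cartesian_product flip: UNIV_Times_UNIV)

lemma norm_factor:
  assumes "norm \<psi> = 1" "norm \<phi> = 1"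
    and "(norm \<psi>)\<^sup>2 = (norm (\<phi> :: qubit))\<^sup>2 * (norm (\<xi> :: qubits2))\<^sup>2"
  shows "norm \<xi> = 1"
proof -
  have "(norm \<xi>)\<^sup>2 = 1" using assms by simp
  then show ?thesis by (rule norm_eq_1I)
qed

text \<open>Only the \<open>perp x\<close> component of the first party survives, so
  \<open>\<psi>\<close> is the conjugate of \<open>perp x\<close> tensored with
  \<open>T(perp x, -, -)\<close>. The next two lemmas do the same for the other parties.\<close>

lemma biseparable_if_vanishing_1:
  assumes "norm \<psi> = 1" "norm x = 1" "\<And>y z. trilin \<psi> x y z = 0"
  shows "biseparable \<psi>"
proof -
  define \<phi> :: qubit where "\<phi> = (\<chi> i. cnj (perp x $ i))"
  define \<xi> :: qubits2 where "\<xi> = (\<chi> c. trilin \<psi> (perp x) (axis (fst c) 1) (axis (snd c) 1))"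
  have eq: "\<psi> $ (i, j, k) = \<phi> $ i * \<xi> $ (j, k)" for i j k
  proof -
    have "\<psi> $ (i, j, k) = trilin \<psi> (axis i 1) (axis j 1) (axis k 1)" by (simp add: trilin_axis)
    also have "\<dots> = braket (perp x) (axis i 1) * trilin \<psi> (perp x) (axis j 1) (axis k 1)"
      by (subst comb_surj[OF assms(2), of "axis i 1"]) (simp add: trilin_comb assms(3))
    also have "braket (perp x) (axis i 1) = \<phi> $ i"
      using exhaust_2[of i] by (auto simp: \<phi>_def braket_qubit axis_def)
    finally show ?thesis by (simp add: \<xi>_def)
  qed
  have "norm \<phi> = norm (perp x)"
    by (rule power2_eq_imp_eq) (simp_all add: norm_qubit_sq \<phi>_def)
  then have \<phi>: "norm \<phi> = 1" using assms(2) by simp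
  have "norm \<xi> = 1"
    by (rule norm_factor[OF assms(1) \<phi>])
      (simp add: norm_vec_sq sum_qubits3 sum_qubits2 eq norm_mult power_mult_distrib sum_2 algebra_simps)
  with eq \<phi> show ?thesis unfolding biseparable_def by blast
qed

lemma biseparable_if_vanishing_2:
  assumes "norm \<psi> = 1" "norm y = 1" "\<And>x z. trilin \<psi> x y z = 0"
  shows "biseparable \<psi>"
proof -
  define \<phi> :: qubit where "\<phi> = (\<chi> j. cnj (perp y $ j))"
  define \<xi> :: qubits2 where "\<xi> = (\<chi> c. trilin \<psi> (axis (fst c) 1) (perp y) (axis (snd c) 1))"
  have eq: "\<psi> $ (i, j, k) = \<phi> $ j * \<xi> $ (i, k)" for i j k
  proof -
    have "\<psi> $ (i, j, k) = trilin \<psi> (axis i 1) (axis j 1) (axis k 1)" by (simp add: trilin_axis)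
    also have "\<dots> = braket (perp y) (axis j 1) * trilin \<psi> (axis i 1) (perp y) (axis k 1)"
      by (subst comb_surj[OF assms(2), of "axis j 1"]) (simp add: trilin_comb assms(3))
    also have "braket (perp y) (axis j 1) = \<phi> $ j"
      using exhaust_2[of j] by (auto simp: \<phi>_def braket_qubit axis_def)
    finally show ?thesis by (simp add: \<xi>_def)
  qed
  have "norm \<phi> = norm (perp y)"
    by (rule power2_eq_imp_eq) (simp_all add: norm_qubit_sq \<phi>_def)
  then have \<phi>: "norm \<phi> = 1" using assms(2) by simp
  have "norm \<xi> = 1"
    by (rule norm_factor[OF assms(1) \<phi>])
      (simp add: norm_vec_sq sum_qubits3 sum_qubits2 eq norm_mult power_mult_distrib sum_2 algebra_simps)
  with eq \<phi> show ?thesis unfolding biseparable_def by blast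
qed

lemma biseparable_if_vanishing_3:
  assumes "norm \<psi> = 1" "norm z = 1" "\<And>x y. trilin \<psi> x y z = 0"
  shows "biseparable \<psi>"
proof -
  define \<phi> :: qubit where "\<phi> = (\<chi> k. cnj (perp z $ k))"
  define \<xi> :: qubits2 where "\<xi> = (\<chi> c. trilin \<psi> (axis (fst c) 1) (axis (snd c) 1) (perp z))"
  have eq: "\<psi> $ (i, j, k) = \<phi> $ k * \<xi> $ (i, j)" for i j k
  proof -
    have "\<psi> $ (i, j, k) = trilin \<psi> (axis i 1) (axis j 1) (axis k 1)" by (simp add: trilin_axis)
    also have "\<dots> = braket (perp z) (axis k 1) * trilin \<psi> (axis i 1) (axis j 1) (perp z)"
      by (subst comb_surj[OF assms(2), of "axis k 1"]) (simp add: trilin_comb assms(3))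
    also have "braket (perp z) (axis k 1) = \<phi> $ k"
      using exhaust_2[of k] by (auto simp: \<phi>_def braket_qubit axis_def)
    finally show ?thesis by (simp add: \<xi>_def)
  qed
  have "norm \<phi> = norm (perp z)"
    by (rule power2_eq_imp_eq) (simp_all add: norm_qubit_sq \<phi>_def)
  then have \<phi>: "norm \<phi> = 1" using assms(2) by simp
  have "norm \<xi> = 1"
    by (rule norm_factor[OF assms(1) \<phi>])
      (simp add: norm_vec_sq sum_qubits3 sum_qubits2 eq norm_mult power_mult_distrib sum_2 algebra_simps)
  with eq \<phi> show ?thesis unfolding biseparable_def by blast
qed

section \<open>Vectors with vanishing contraction\<close>

lemma quadratic_form_isotropic:
  "\<exists>z :: qubit. z \<noteq> 0 \<and> \<alpha> * (z $ 1)\<^sup>2 + \<beta> * z $ 1 * z $ 2 + \<gamma> * (z $ 2)\<^sup>2 = 0"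
proof (cases "\<gamma> = 0")
  case True
  then show ?thesis by (intro exI[of _ "axis 2 1"]) (simp add: axis_eq_0_iff, simp add: axis_def)
next
  case False
  define d where "d = csqrt (\<beta>\<^sup>2 - 4 * \<alpha> * \<gamma>)"
  define s where "s = (d - \<beta>) / (2 * \<gamma>)"
  define z :: qubit where "z = vector [1, s]"
  have z: "z $ 1 = 1" "z $ 2 = s" by (simp_all add: z_def)
  have "2 * \<gamma> * s = d - \<beta>" using False by (simp add: s_def)
  then have "(2 * \<gamma> * s + \<beta>)\<^sup>2 = \<beta>\<^sup>2 - 4 * \<alpha> * \<gamma>" by (simp add: d_def)
  then have "4 * \<gamma> * (\<alpha> + \<beta> * s + \<gamma> * s\<^sup>2) = 0" by (simp add: power2_eq_square algebra_simps)
  then have "\<alpha> + \<beta> * s + \<gamma> * s\<^sup>2 = 0" using False by simp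
  moreover have "z \<noteq> 0" using z(1) by auto
  ultimately show ?thesis by (intro exI[of _ z]) (simp add: z)
qed

lemma parallel_imp_dependent:
  fixes f g :: qubit
  assumes "f $ 1 * g $ 2 = f $ 2 * g $ 1"
  shows "\<exists>y :: qubit. y \<noteq> 0 \<and> y $ 1 *s f + y $ 2 *s g = 0"
proof -
  have *: ?thesis if "f $ i \<noteq> 0 \<or> g $ i \<noteq> 0" for i
  proof -
    define y :: qubit where "y = vector [g $ i, - f $ i]"
    have y: "y $ 1 = g $ i" "y $ 2 = - f $ i" by (simp_all add: y_def)
    then have "y \<noteq> 0" using that by auto
    moreover have "y $ 1 *s f + y $ 2 *s g = 0"
      using exhaust_2[of i] assms by (auto simp: vec_eq_iff forall_2 y algebra_simps)
    ultimately show ?thesis by blast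
  qed
  show ?thesis
  proof (cases "f = 0")
    case True
    then show ?thesis by (intro exI[of _ "axis 1 1"]) (simp add: axis_eq_0_iff, simp add: axis_def)
  next
    case False
    then show ?thesis using * by (metis vec_eq_iff zero_index)
  qed
qed

lemma exists_unit_contr_eq_0:
  obtains y z where "norm y = 1" "norm z = 1" "contr \<psi> y z = 0"
proof -
  define p where "p i j k = \<psi> $ (i, j, k)" for i j k
  obtain z :: qubit where z: "z \<noteq> 0" and
    \<comment> \<open>The determinant of the matrix with columns
      \<open>contr \<psi> (axis 1 1) z\<close> and \<open>contr \<psi> (axis 2 1) z\<close>; a
      kernel vector of it serves as \<open>y\<close>.\<close>
    "(p 1 1 1 * p 2 2 1 - p 2 1 1 * p 1 2 1) * (z $ 1)\<^sup>2
      + (p 1 1 1 * p 2 2 2 + p 1 1 2 * p 2 2 1 - p 2 1 1 * p 1 2 2 - p 2 1 2 * p 1 2 1) * z $ 1 * z $ 2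
      + (p 1 1 2 * p 2 2 2 - p 2 1 2 * p 1 2 2) * (z $ 2)\<^sup>2 = 0"
    using quadratic_form_isotropic by blast
  then have "contr \<psi> (axis 1 1) z $ 1 * contr \<psi> (axis 2 1) z $ 2
      = contr \<psi> (axis 1 1) z $ 2 * contr \<psi> (axis 2 1) z $ 1"
    by (simp add: contr_def sum_2 axis_def p_def power2_eq_square algebra_simps)
  from parallel_imp_dependent[OF this] obtain y :: qubit where y: "y \<noteq> 0"
    "y $ 1 *s contr \<psi> (axis 1 1) z + y $ 2 *s contr \<psi> (axis 2 1) z = 0"
    by blast
  have "contr \<psi> y z = y $ 1 *s contr \<psi> (axis 1 1) z + y $ 2 *s contr \<psi> (axis 2 1) z"
    by (simp add: vec_eq_iff contr_def sum_2 axis_def algebra_simps)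
  then have "contr \<psi> y z = 0" using y(2) by simp
  moreover obtain r s where "norm (complex_of_real r *s y) = 1" "norm (complex_of_real s *s z) = 1"
    using scale_unit[OF y(1)] scale_unit[OF z] by metis
  ultimately show thesis
    by (intro that[of "complex_of_real r *s y" "complex_of_real s *s z"]) (simp_all add: contr_scale)
qed

lemma bell_violating_if_entangled:
  assumes "genuinely_multipartite_entangled \<psi>"
  shows "bell_violating \<psi>"
proof -
  have norm: "norm \<psi> = 1" and nb: "\<not> biseparable \<psi>"
    using assms by (auto simp: genuinely_multipartite_entangled_def)
  obtain y z where y: "norm y = 1" and z: "norm z = 1" and yz: "contr \<psi> y z = 0"
    by (rule exists_unit_contr_eq_0)
  then have yz': "trilin \<psi> x y z = 0" for x by (simp add: trilin_eq_dot dot_def)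
  define w where "w = contr \<psi> (perp y) z"
  \<comment> \<open>This fact, \<open>nz1\<close> and \<open>nz2\<close> each use that one partition
    is excluded: 3|12, 2|13 and 1|23, respectively.\<close>
  have "w \<noteq> 0"
  proof
    assume "w = 0"
    then have "trilin \<psi> x (perp y) z = 0" for x by (simp add: w_def trilin_eq_dot dot_def)
    then have "trilin \<psi> x q z = 0" for x q
      by (subst comb_surj[OF y, of q]) (simp add: trilin_comb yz')
    then show False using biseparable_if_vanishing_3[OF norm z] nb by blast
  qed
  \<comment> \<open>The first party's basis is chosen so that \<open>w\<close> has only a component
    along the first basis vector.\<close>
  define x :: qubit where "x = (\<chi> i. cnj (w $ i) / norm w)"
  have "(norm x)\<^sup>2 = (norm w)\<^sup>2 / (norm w)\<^sup>2"
    unfolding norm_qubit_sq[of x] norm_qubit_sq[of w] power_divide add_divide_distrib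
    using \<open>w \<noteq> 0\<close> by (simp add: x_def norm_divide power_divide norm_qubit_sq)
  then have x: "norm x = 1" using \<open>w \<noteq> 0\<close> by (intro norm_eq_1I) simp
  have xw: "dot (perp x) w = 0" by (simp add: dot_def x_def)
  have "dot x w = braket w w / norm w"
    by (simp add: dot_def x_def braket_qubit add_divide_distrib)
  then have xw': "dot x w \<noteq> 0" using \<open>w \<noteq> 0\<close> by (simp add: braket_self)

  define \<psi>' where "\<psi>' = rotate3 x y z \<psi>"
  have \<psi>': "\<psi>' $ (1, 1, 1) = 0" "\<psi>' $ (2, 1, 1) = 0" "\<psi>' $ (2, 2, 1) = 0"
    using xw yz' by (simp_all add: \<psi>'_def rotate3_nth w_def trilin_eq_dot)
  have \<omega>: "\<psi>' $ (1, 2, 1) \<noteq> 0"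
    using xw' by (simp only: \<psi>'_def rotate3_nth comb_axis trilin_eq_dot flip: w_def) simp
  have nz1: "\<psi>' $ (1, 1, 2) \<noteq> 0 \<or> \<psi>' $ (2, 1, 2) \<noteq> 0"
  proof (rule ccontr)
    assume "\<not> ?thesis"
    then have "trilin \<psi> x y (perp z) = 0" "trilin \<psi> (perp x) y (perp z) = 0"
      by (simp_all only: \<psi>'_def rotate3_nth comb_axis) simp_all
    then have "trilin \<psi> (comb x p) y (comb z q) = 0" for p q
      by (simp add: trilin_comb yz')
    then have "trilin \<psi> p y q = 0" for p q
      using comb_surj[OF x, of p] comb_surj[OF z, of q] by metis
    then show False using biseparable_if_vanishing_2[OF norm y] nb by blast
  qed
  have nz2: "\<psi>' $ (2, 1, 2) \<noteq> 0 \<or> \<psi>' $ (2, 2, 2) \<noteq> 0"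
  proof (rule ccontr)
    assume "\<not> ?thesis"
    then have "trilin \<psi> (perp x) y (perp z) = 0" "trilin \<psi> (perp x) (perp y) (perp z) = 0"
      by (simp_all only: \<psi>'_def rotate3_nth comb_axis) simp_all
    moreover have "trilin \<psi> (perp x) (perp y) z = 0"
      using xw by (simp add: trilin_eq_dot flip: w_def)
    ultimately have "trilin \<psi> (perp x) (comb y p) (comb z q) = 0" for p q
      by (simp add: trilin_comb yz')
    then have "trilin \<psi> (perp x) p q = 0" for p q
      using comb_surj[OF y, of p] comb_surj[OF z, of q] by metis
    moreover have "norm (perp x) = 1" using x by simp
    ultimately show False using biseparable_if_vanishing_1[OF norm] nb by blast
  qed

  have "bell_violating \<psi>'"
  proof (cases "\<psi>' $ (1, 1, 2) \<noteq> 0 \<or> \<psi>' $ (2, 1, 2) \<noteq> 0 \<and> \<psi>' $ (2, 2, 2) \<noteq> 0")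
    case True
    then show ?thesis
      using bell_violating_normal_form[of \<psi>'] \<psi>' \<omega> nz2 by blast
  next
    case False
    then have u: "\<psi>' $ (1, 1, 2) = 0" "\<psi>' $ (2, 1, 2) \<noteq> 0" "\<psi>' $ (2, 2, 2) = 0"
      using nz1 by auto
    show ?thesis
    proof (cases "\<psi>' $ (1, 2, 2) = 0")
      case True
      then show ?thesis using bell_violating_GHZ[of \<psi>'] \<psi>' \<omega> u by blast
    next
      case a: False
      \<comment> \<open>Exchanging the last two parties and the basis vectors of the first restores the normal form.\<close>
      define \<psi>'' where "\<psi>'' = rotate3 (axis 2 1) (axis 1 1) (axis 1 1)
        (\<chi> c. case c of (i, j, k) \<Rightarrow> \<psi>' $ (i, k, j))"
      have p: "perp (axis 1 1) = axis 2 1" "perp (axis 2 1) = - axis 1 1"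
        by (simp_all add: vec_eq_iff forall_2 axis_def)
      have m: "trilin \<phi> (- p) q r = - trilin \<phi> p q r" for \<phi> p q r
        by (simp add: trilin_expand sum_2 algebra_simps)
      \<comment> \<open>Now \<open>u0 = 0\<close>, while \<open>u1\<close> and \<open>b\<close> are
        the negatives of \<open>\<psi>' $ (1, 2, 1)\<close> and \<open>\<psi>' $ (1, 2, 2)\<close>,
        both nonzero.\<close>
      have "bell_violating \<psi>''"
      proof (rule bell_violating_normal_form)
        show "\<psi>'' $ (1, 1, 1) = 0" "\<psi>'' $ (2, 1, 1) = 0" "\<psi>'' $ (2, 2, 1) = 0" "\<psi>'' $ (1, 1, 2) = 0"
          "\<psi>'' $ (1, 2, 1) = \<psi>' $ (2, 1, 2)" "\<psi>'' $ (2, 1, 2) = - \<psi>' $ (1, 2, 1)"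
          "\<psi>'' $ (1, 2, 2) = 0" "\<psi>'' $ (2, 2, 2) = - \<psi>' $ (1, 2, 2)"
          using \<psi>' u by (simp_all only: \<psi>''_def rotate3_nth comb_axis p m trilin_axis) simp_all
      qed (use u \<omega> a in auto)
      then have "bell_violating (\<chi> c. case c of (i, j, k) \<Rightarrow> \<psi>' $ (i, k, j))"
        unfolding \<psi>''_def by (rule bell_violating_rotate3) (simp_all add: norm_eq_1I norm_qubit_sq axis_def)
      then show ?thesis by (rule bell_violating_swap)
    qed
  qed
  then show ?thesis
    unfolding \<psi>'_def using x y z by (rule bell_violating_rotate3)
qed

theorem theorem2:
  fixes \<psi> :: qubits3
  assumes "genuinely_multipartite_entangled \<psi>"
  shows "\<exists>A B C :: 2 \<Rightarrow> 2 \<Rightarrow> complex ^ 2 ^ 2.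
    (\<forall>x. measurement (A x)) \<and> (\<forall>x. measurement (B x)) \<and> (\<forall>x. measurement (C x)) \<and>
    (let p = correlation \<psi> A B C in
      p (0,0,0) (0,0,0) - p (1,0,0) (1,0,0) - p (0,1,0) (0,1,0) - p (0,0,1) (0,0,1)
        - p (0,0,0) (1,1,0) - p (0,0,0) (1,0,1) > 0)"
  using bell_violating_imp_measurements[OF bell_violating_if_entangled[OF assms]] .

end
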